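(* Let $n\ge3$ and $0<r<\frac n2$, or let $n=2$ and $r=1$. Let $B_1(0)$ be the open unit ball of $\mathbf R^n$. For every $\epsilon>0$ one can find a non-negative $V_\epsilon\in L^r(B_1(0))$ and a nontrivial distributional solution $u\in W^{1,2}_0(B_1(0))$ (depending on $\epsilon$) of $-\Delta u=V_\epsilon u$, such that $$\lim_{\epsilon\to0}\|V_\epsilon\|_{r}=0 .$$
   Context: $W^{1,2}_0(B_1(0))$ is the closure of $C_0^\infty(B_1(0))$ with respect to $\|\nabla u\|_2$. $\|V\|_r=\big(\int_{B_1(0)}|V|^r\,dx\big)^{1/r}$. Distributional solution means $\int\nabla u\cdot\nabla\psi\,dx=\int V_\epsilon u\psi\,dx$ for all $\psi\in C_0^\infty(B_1(0))$; nontrivial means not a.e. zero. *)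

theory Defs
  imports "HOL-Analysis.Analysis"
begin

definition partial_deriv :: "'n::finite \<Rightarrow> (real ^ 'n \<Rightarrow> real) \<Rightarrow> real ^ 'n \<Rightarrow> real"
  where "partial_deriv i f x = frechet_derivative f (at x) (axis i 1)"

definition grad :: "(real ^ 'n::finite \<Rightarrow> real) \<Rightarrow> real ^ 'n \<Rightarrow> real ^ 'n"
  where "grad f x = (\<chi> i. partial_deriv i f x)"

primrec iterated_partial :: "'n::finite list \<Rightarrow> (real ^ 'n \<Rightarrow> real) \<Rightarrow> real ^ 'n \<Rightarrow> real"
  where
    "iterated_partial [] f = f"
  | "iterated_partial (i # js) f = partial_deriv i (iterated_partial js f)"

(* Class C^infinity on the whole space: partial derivatives of all orders exist and are
   (Frechet) differentiable, hence continuous. *)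
definition smooth :: "(real ^ 'n::finite \<Rightarrow> real) \<Rightarrow> bool"
  where "smooth f \<longleftrightarrow> (\<forall>js. iterated_partial js f differentiable_on UNIV)"

(* Test functions on \<Omega>, extended by zero to the whole space. *)
definition test_fun :: "(real ^ 'n::finite) set \<Rightarrow> (real ^ 'n \<Rightarrow> real) \<Rightarrow> bool"
  where "test_fun \<Omega> \<psi> \<longleftrightarrow>
    smooth \<psi> \<and> compact (closure {x. \<psi> x \<noteq> 0}) \<and> closure {x. \<psi> x \<noteq> 0} \<subseteq> \<Omega>"

(* Exponents 0 < p < 1 are allowed; Lp_norm is then only a quasi-norm. For p > 0 the convention
   0 powr p = 0 is the right one. *)
definition in_Lp :: "'a measure \<Rightarrow> real \<Rightarrow> ('a \<Rightarrow> 'b::euclidean_space) \<Rightarrow> bool"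
  where "in_Lp M p f \<longleftrightarrow> f \<in> borel_measurable M \<and> integrable M (\<lambda>x. norm (f x) powr p)"

definition Lp_norm :: "'a measure \<Rightarrow> real \<Rightarrow> ('a \<Rightarrow> 'b::euclidean_space) \<Rightarrow> real"
  where "Lp_norm M p f = (LINT x|M. norm (f x) powr p) powr (1 / p)"

definition locally_integrable ::
    "'a::euclidean_space set \<Rightarrow> ('a \<Rightarrow> 'b::euclidean_space) \<Rightarrow> bool"
  where "locally_integrable \<Omega> f \<longleftrightarrow>
    (\<forall>K. compact K \<and> K \<subseteq> \<Omega> \<longrightarrow> f absolutely_integrable_on K)"

definition has_weak_grad ::
    "(real ^ 'n::finite) set \<Rightarrow> (real ^ 'n \<Rightarrow> real) \<Rightarrow> (real ^ 'n \<Rightarrow> real ^ 'n) \<Rightarrow> bool"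
  where "has_weak_grad \<Omega> u g \<longleftrightarrow>
    locally_integrable \<Omega> u \<and> locally_integrable \<Omega> g \<and>
    (\<forall>\<psi> i. test_fun \<Omega> \<psi> \<longrightarrow>
      (LINT x|lebesgue_on \<Omega>. u x * partial_deriv i \<psi> x) =
      - (LINT x|lebesgue_on \<Omega>. g x $ i * \<psi> x))"

(* The closure of the test functions in the norm of grad u in L^2, for a bounded open set \<Omega>.
   The limit is realised as a function: by the Poincare inequality a sequence of test functions
   that is Cauchy in this norm converges in L^2, and its limit u is the element of the closure.
   Convergence of the gradients alone would determine u only up to a constant. *)
definition in_W012 :: "(real ^ 'n::finite) set \<Rightarrow> (real ^ 'n \<Rightarrow> real) \<Rightarrow> bool"
  where "in_W012 \<Omega> u \<longleftrightarrow>
    in_Lp (lebesgue_on \<Omega>) 2 u \<and>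
    (\<exists>g. has_weak_grad \<Omega> u g \<and> in_Lp (lebesgue_on \<Omega>) 2 g \<and>
      (\<exists>\<phi> :: nat \<Rightarrow> real ^ 'n \<Rightarrow> real.
        (\<forall>k. test_fun \<Omega> (\<phi> k)) \<and>
        (\<lambda>k. Lp_norm (lebesgue_on \<Omega>) 2 (\<lambda>x. grad (\<phi> k) x - g x)) \<longlonglongrightarrow> 0 \<and>
        (\<lambda>k. Lp_norm (lebesgue_on \<Omega>) 2 (\<lambda>x. \<phi> k x - u x)) \<longlonglongrightarrow> 0))"

(* - Laplace u = V u in the sense of distributions. Local integrability of V u makes the
   right-hand integrals meaningful; the weak gradient is unique up to null sets, so that the
   choice of g is immaterial. *)
definition distributional_solution ::
    "(real ^ 'n::finite) set \<Rightarrow> (real ^ 'n \<Rightarrow> real) \<Rightarrow> (real ^ 'n \<Rightarrow> real) \<Rightarrow> bool"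
  where "distributional_solution \<Omega> V u \<longleftrightarrow>
    locally_integrable \<Omega> (\<lambda>x. V x * u x) \<and>
    (\<exists>g. has_weak_grad \<Omega> u g \<and>
      (\<forall>\<psi>. test_fun \<Omega> \<psi> \<longrightarrow>
        (LINT x|lebesgue_on \<Omega>. g x \<bullet> grad \<psi> x) = (LINT x|lebesgue_on \<Omega>. V x * u x * \<psi> x)))"

end

(* Idea. Take u(x) = F(|x|^2) with F(1) = 0 and F'(s) = - q(s)^(-n/2), where q(s) = e Q(s/e) is a
   smooth positive convex function equal to s for s >= e. For |x|^2 >= e, u is an affine function of
   the fundamental solution, and in general
     - Laplace u = 2 n q^(-n/2-1) (q - s q')   at s = |x|^2,
   which is non-negative by convexity, vanishes for s >= e and is O(e^(-n/2)). Hence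
   V = - (Laplace u) / u is O(e^(-n/2) / F(e)) and lives on a ball of volume O(e^(n/2)). For n >= 3,
   F(e) is of order e^(1-n/2), so the integral of V^r is O(e^(n/2-r)); for n = 2, F(e) = - ln e and
   the integral of V is O(1 / |ln e|). As u is smooth on the whole space and is positive exactly in
   the ball, truncating its values from below gives the approximating test functions, and the
   equation is an integration by parts. *)

theory Submission
  imports Defs "HOL-Real_Asymp.Real_Asymp"
begin

section \<open>Smooth functions\<close>

text \<open>The exponent n/2 is critical for the scaling x -> x / sqrt e. For n >= 3 the bound on V
  is a multiple of 1/e on a ball of radius sqrt e, and the resulting bound on the L^r norm tends to
  0 because r < n/2. For n = 2 and r = 1 the powers of e cancel, and only the logarithm in the
  fundamental solution is left to produce smallness. The power s^(-n/2) solves n p + 2 s p' = 0, the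
  radial Laplace equation in s = |x|^2. The difficulty is to remove its singularity at s = 0 without
  losing the sign of the Laplacian. Putting q in place of s inside the power leaves the factor q - s
  q', the intercept at 0 of a tangent to q, and this is what makes convexity the right condition.
  Using s instead of |x| keeps compositions smooth at the origin. Since q is positive on the whole
  line, u is smooth beyond the unit sphere as well, so no boundary regularity enters. Since
  \<open>smooth\<close> speaks of all iterated partial derivatives, it is verified through inductive
  classes that are closed under differentiation.\<close>

definition flat_powr :: "real \<Rightarrow> real \<Rightarrow> real"
  where "flat_powr a t = (if t > 0 then t powr a * exp (- 1 / t) else 0)"

lemma flat_powr_tendsto_0: "((\<lambda>t. flat_powr a t) \<longlongrightarrow> 0) (at_right 0)"
proof -
  have "((\<lambda>t::real. t powr a * exp (- 1 / t)) \<longlongrightarrow> 0) (at_right 0)"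
    by real_asymp
  then show ?thesis
    by (rule Lim_transform_eventually)
      (auto simp: flat_powr_def eventually_at_right_field intro!: exI[of _ 1])
qed

text \<open>The exponent is a parameter because differentiating t powr a * exp (- 1 / t) yields
  members of the same family with exponents a - 1 and a - 2. At 0 the right difference quotient is
  \<open>flat_powr (a - 1)\<close>, which tends to 0, and the left one is 0.\<close>

lemma flat_powr_has_derivative:
  "(flat_powr a has_real_derivative a * flat_powr (a - 1) t + flat_powr (a - 2) t) (at t)"
proof -
  consider "t > 0" | "t < 0" | "t = 0" by linarith
  then show ?thesis
  proof cases
    case 1
    have "((\<lambda>t. t powr a * exp (- 1 / t)) has_real_derivative
        a * flat_powr (a - 1) t + flat_powr (a - 2) t) (at t)"
      using 1 by (auto intro!: derivative_eq_intros
          simp: flat_powr_def powr_diff field_simps power2_eq_square)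
    then show ?thesis
      by (rule has_field_derivative_transform_within_open[where S = "{0<..}"])
        (use 1 in \<open>auto simp: flat_powr_def\<close>)
  next
    case 2
    have "((\<lambda>t. 0) has_real_derivative a * flat_powr (a - 1) t + flat_powr (a - 2) t) (at t)"
      using 2 by (simp add: flat_powr_def)
    then show ?thesis
      by (rule has_field_derivative_transform_within_open[where S = "{..<0}"])
        (use 2 in \<open>auto simp: flat_powr_def\<close>)
  next
    case 3
    have "((\<lambda>h. (flat_powr a h - flat_powr a 0) / h) \<longlongrightarrow> 0) (at_right 0)"
    proof (rule Lim_transform_eventually[OF flat_powr_tendsto_0[of "a - 1"]])
      show "\<forall>\<^sub>F h in at_right 0. flat_powr (a - 1) h = (flat_powr a h - flat_powr a 0) / h"
        by (auto simp: flat_powr_def eventually_at_right_field powr_diff intro!: exI[of _ 1])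
    qed
    moreover have "((\<lambda>h. (flat_powr a h - flat_powr a 0) / h) \<longlongrightarrow> 0) (at_left 0)"
      by (rule Lim_transform_eventually[OF tendsto_const])
        (auto simp: flat_powr_def eventually_at_left_field intro!: exI[of _ "-1"])
    ultimately have "((\<lambda>h. (flat_powr a h - flat_powr a 0) / h) \<longlongrightarrow> 0) (at 0)"
      by (simp add: filterlim_split_at)
    then show ?thesis
      using 3 by (simp add: has_field_derivative_iff flat_powr_def)
  qed
qed

text \<open>
  The classes \<open>smooth_real\<close> and \<open>smooth_vec\<close> do not contain every smooth function; they are
  chosen to be closed under differentiation and to contain the functions needed here.
\<close>

inductive smooth_real :: "(real \<Rightarrow> real) \<Rightarrow> bool" where
  const: "smooth_real (\<lambda>t. c)"
| ident: "smooth_real (\<lambda>t. t)"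
| add: "smooth_real f \<Longrightarrow> smooth_real g \<Longrightarrow> smooth_real (\<lambda>t. f t + g t)"
| mult: "smooth_real f \<Longrightarrow> smooth_real g \<Longrightarrow> smooth_real (\<lambda>t. f t * g t)"
| flat: "smooth_real (flat_powr a)"
| powr: "smooth_real f \<Longrightarrow> (\<And>t. f t > 0) \<Longrightarrow> smooth_real (\<lambda>t. f t powr a)"
| comp: "smooth_real f \<Longrightarrow> smooth_real g \<Longrightarrow> smooth_real (\<lambda>t. g (f t))"
| antideriv: "smooth_real g \<Longrightarrow> (\<And>t. (f has_real_derivative g t) (at t)) \<Longrightarrow> smooth_real f"

text \<open>Each constructor has a derivative that the constructors build again, so the lemma can be
  iterated. The \<open>antideriv\<close> case supplies its own derivative; that constructor admits
  functions known only through their derivative, such as the primitives used later.\<close>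

lemma smooth_real_derivative:
  assumes "smooth_real f"
  shows "\<exists>f'. smooth_real f' \<and> (\<forall>t. (f has_real_derivative f' t) (at t))"
  using assms
proof induction
  case (const c)
  show ?case by (rule exI[of _ "\<lambda>t. 0"]) (auto intro: smooth_real.intros)
next
  case ident
  show ?case by (rule exI[of _ "\<lambda>t. 1"]) (auto intro: smooth_real.intros)
next
  case (add f g)
  then obtain f' g' where "smooth_real f'" "\<forall>t. (f has_real_derivative f' t) (at t)"
    "smooth_real g'" "\<forall>t. (g has_real_derivative g' t) (at t)" by blast
  then show ?case
    by (intro exI[of _ "\<lambda>t. f' t + g' t"]) (auto intro!: smooth_real.add derivative_intros)
next
  case (mult f g)
  then obtain f' g' where "smooth_real f'" "\<forall>t. (f has_real_derivative f' t) (at t)"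
    "smooth_real g'" "\<forall>t. (g has_real_derivative g' t) (at t)" by blast
  with mult.hyps show ?case
    by (intro exI[of _ "\<lambda>t. f' t * g t + g' t * f t"])
      (auto intro!: smooth_real.add smooth_real.mult DERIV_mult)
next
  case (flat a)
  show ?case
    by (intro exI[of _ "\<lambda>t. a * flat_powr (a - 1) t + flat_powr (a - 2) t"])
      (auto intro!: smooth_real.add smooth_real.mult smooth_real.const smooth_real.flat flat_powr_has_derivative)
next
  case (powr f a)
  then obtain f' where f': "smooth_real f'" "\<forall>t. (f has_real_derivative f' t) (at t)" by blast
  have "((\<lambda>t. f t powr a) has_real_derivative a * f t powr (a - 1) * f' t) (at t)" for t
    using DERIV_fun_powr[of f "f' t" t a] f' powr.hyps by simp
  moreover have "smooth_real (\<lambda>t. a * f t powr (a - 1) * f' t)"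
    using f' powr.hyps by (auto intro!: smooth_real.mult smooth_real.powr smooth_real.const)
  ultimately show ?case by blast
next
  case (comp f g)
  then obtain f' g' where "smooth_real f'" "\<forall>t. (f has_real_derivative f' t) (at t)"
    "smooth_real g'" "\<forall>t. (g has_real_derivative g' t) (at t)" by blast
  with comp.hyps show ?case
    by (intro exI[of _ "\<lambda>t. g' (f t) * f' t"])
      (auto intro!: smooth_real.mult intro: smooth_real.comp DERIV_chain2)
next
  case (antideriv g f)
  then show ?case by blast
qed

inductive smooth_vec :: "(real ^ 'n::finite \<Rightarrow> real) \<Rightarrow> bool" where
  const: "smooth_vec (\<lambda>x. c)"
| coord: "smooth_vec (\<lambda>x. x $ i)"
| add: "smooth_vec f \<Longrightarrow> smooth_vec g \<Longrightarrow> smooth_vec (\<lambda>x. f x + g x)"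
| mult: "smooth_vec f \<Longrightarrow> smooth_vec g \<Longrightarrow> smooth_vec (\<lambda>x. f x * g x)"
| comp: "smooth_vec f \<Longrightarrow> smooth_real g \<Longrightarrow> smooth_vec (\<lambda>x. g (f x))"

text \<open>Only the values of the derivative on basis vectors have to stay in the class, since
  these are the partial derivatives. The full derivative D is carried along because existence of
  partial derivatives alone would not give differentiability.\<close>

lemma smooth_vec_derivative:
  fixes f :: "real ^ 'n::finite \<Rightarrow> real"
  assumes "smooth_vec f"
  shows "\<exists>D. (\<forall>x. (f has_derivative D x) (at x)) \<and> (\<forall>i. smooth_vec (\<lambda>x. D x (axis i 1)))"
  using assms
proof induction
  case (const c)
  show ?case by (rule exI[of _ "\<lambda>x h. 0"]) (auto intro: smooth_vec.intros)
next
  case (coord i)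
  have "((\<lambda>x. x $ i) has_derivative (\<lambda>h. h $ i)) (at x)" for x :: "real ^ 'n"
    by (intro bounded_linear_imp_has_derivative bounded_linear_vec_nth)
  then show ?case by (intro exI[of _ "\<lambda>x h. h $ i"]) (auto intro: smooth_vec.const)
next
  case (add f g)
  then obtain D E where "\<forall>x. (f has_derivative D x) (at x)" "\<forall>i. smooth_vec (\<lambda>x. D x (axis i 1))"
    "\<forall>x. (g has_derivative E x) (at x)" "\<forall>i. smooth_vec (\<lambda>x. E x (axis i 1))" by blast
  then show ?case
    by (intro exI[of _ "\<lambda>x h. D x h + E x h"]) (auto intro!: smooth_vec.add has_derivative_add)
next
  case (mult f g)
  then obtain D E where "\<forall>x. (f has_derivative D x) (at x)" "\<forall>i. smooth_vec (\<lambda>x. D x (axis i 1))"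
    "\<forall>x. (g has_derivative E x) (at x)" "\<forall>i. smooth_vec (\<lambda>x. E x (axis i 1))" by blast
  with mult.hyps show ?case
    by (intro exI[of _ "\<lambda>x h. f x * E x h + D x h * g x"])
      (auto intro!: smooth_vec.add smooth_vec.mult has_derivative_mult)
next
  case (comp f g)
  then obtain D where D: "\<forall>x. (f has_derivative D x) (at x)" "\<forall>i. smooth_vec (\<lambda>x. D x (axis i 1))"
    by blast
  obtain g' where g': "smooth_real g'" "\<And>t. (g has_real_derivative g' t) (at t)"
    using smooth_real_derivative[OF comp.hyps(2)] by blast
  have "((\<lambda>x. g (f x)) has_derivative (\<lambda>h. g' (f x) * D x h)) (at x)" for x
    using has_derivative_compose[of f "D x" x UNIV g "(*) (g' (f x))"] D(1) g'(2)[of "f x"]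
    by (auto simp: has_field_derivative_def)
  moreover have "smooth_vec (\<lambda>x. g' (f x) * D x (axis i 1))" for i
    using D(2) g'(1) comp.hyps by (auto intro: smooth_vec.mult smooth_vec.comp)
  ultimately show ?case
    by (intro exI[of _ "\<lambda>x h. g' (f x) * D x h"]) auto
qed

section \<open>Rules for partial derivatives and consequences of smoothness\<close>

lemma partial_deriv_eq: "(f has_derivative D) (at x) \<Longrightarrow> partial_deriv i f x = D (axis i 1)"
  by (simp add: partial_deriv_def frechet_derivative_at[symmetric])

lemma partial_deriv_mult:
  assumes "f differentiable (at x)" "g differentiable (at x)"
  shows "partial_deriv i (\<lambda>x. f x * g x) x = f x * partial_deriv i g x + partial_deriv i f x * g x"
proof -
  have "((\<lambda>x. f x * g x) has_derivative (\<lambda>h. f x * frechet_derivative g (at x) h +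
      frechet_derivative f (at x) h * g x)) (at x)"
    using assms by (intro has_derivative_mult) (simp_all add: frechet_derivative_works[symmetric])
  from partial_deriv_eq[OF this] show ?thesis by (simp add: partial_deriv_def)
qed

lemma partial_deriv_comp:
  assumes "f differentiable (at x)" "(g has_real_derivative g') (at (f x))"
  shows "partial_deriv i (\<lambda>x. g (f x)) x = g' * partial_deriv i f x"
proof -
  have "((\<lambda>x. g (f x)) has_derivative (\<lambda>h. g' * frechet_derivative f (at x) h)) (at x)"
    using has_derivative_compose[of f "frechet_derivative f (at x)" x UNIV g "(*) g'"] assms
    by (auto simp: has_field_derivative_def frechet_derivative_works)
  from partial_deriv_eq[OF this] show ?thesis by (simp add: partial_deriv_def)
qed

lemma smooth_vec_differentiable: "smooth_vec f \<Longrightarrow> f differentiable (at x)"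
  using smooth_vec_derivative[of f] unfolding differentiable_def by blast

lemma smooth_vec_continuous: "smooth_vec f \<Longrightarrow> continuous_on S f"
  using smooth_vec_differentiable
  by (meson continuous_at_imp_continuous_on differentiable_imp_continuous_within)

lemma smooth_vec_partial_deriv:
  assumes "smooth_vec f"
  shows "smooth_vec (partial_deriv i f)"
proof -
  obtain D where D: "\<forall>x. (f has_derivative D x) (at x)" "\<forall>i. smooth_vec (\<lambda>x. D x (axis i 1))"
    using smooth_vec_derivative[OF assms] by blast
  then have "partial_deriv i f = (\<lambda>x. D x (axis i 1))"
    by (auto simp: partial_deriv_eq)
  with D show ?thesis by simp
qed

lemma smooth_vec_imp_smooth:
  assumes "smooth_vec f"
  shows "smooth f"
proof -
  have "smooth_vec (iterated_partial js f)" for js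
    by (induction js) (auto simp: assms smooth_vec_partial_deriv)
  then show ?thesis
    unfolding smooth_def using smooth_vec_differentiable
    by (meson differentiable_at_imp_differentiable_on)
qed

lemma smooth_differentiable: "smooth f \<Longrightarrow> f differentiable (at x)"
  unfolding smooth_def using iterated_partial.simps(1)[where f = f]
  by (metis UNIV_I differentiable_on_def)

lemma smooth_continuous_partial_deriv: "smooth f \<Longrightarrow> continuous_on S (partial_deriv i f)"
  unfolding smooth_def using iterated_partial.simps[where f = f]
  by (metis continuous_on_subset differentiable_imp_continuous_on subset_UNIV)

lemma smooth_vec_sum:
  assumes "finite A" "\<And>a. a \<in> A \<Longrightarrow> smooth_vec (f a)"
  shows "smooth_vec (\<lambda>x. \<Sum>a\<in>A. f a x)"
  using assms by (induction A) (auto intro: smooth_vec.const smooth_vec.add)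

lemma smooth_vec_inner_self: "smooth_vec (\<lambda>x. x \<bullet> x)"
  unfolding inner_vec_def by (auto intro!: smooth_vec_sum smooth_vec.mult smooth_vec.coord)

lemma partial_deriv_inner_self: "partial_deriv i (\<lambda>x. x \<bullet> x) x = 2 * x $ i"
proof -
  have "((\<lambda>x. x \<bullet> x) has_derivative (\<lambda>h. x \<bullet> h + h \<bullet> x)) (at x)"
    by (intro has_derivative_inner has_derivative_ident)
  from partial_deriv_eq[OF this] show ?thesis by (simp add: inner_axis inner_commute)
qed

lemma partial_deriv_coord: "partial_deriv i (\<lambda>x :: real ^ 'n::finite. x $ i) x = 1"
proof -
  have "((\<lambda>x. x $ i) has_derivative (\<lambda>h. h $ i)) (at x)"
    by (intro bounded_linear_imp_has_derivative bounded_linear_vec_nth)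
  from partial_deriv_eq[OF this] show ?thesis by simp
qed

section \<open>Integration by parts\<close>

lemma partial_deriv_eq_0:
  assumes "open U" "x \<in> U" "\<And>y. y \<in> U \<Longrightarrow> f y = 0"
  shows "partial_deriv i f x = 0"
proof -
  have "(f has_derivative (\<lambda>h. 0)) (at x)"
    by (rule has_derivative_transform_within_open[OF has_derivative_const assms(1,2)])
      (use assms(3) in auto)
  from partial_deriv_eq[OF this] show ?thesis .
qed

lemma integrable_lborel_continuous_bounded_support:
  fixes f :: "'a::euclidean_space \<Rightarrow> real"
  assumes "continuous_on UNIV f" "\<And>x. R < norm x \<Longrightarrow> f x = 0"
  shows "integrable lborel f"
proof -
  have "continuous_on (cball 0 R) f"
    using assms(1) continuous_on_subset by blast
  then have "compact (f ` cball 0 R)"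
    by (intro compact_continuous_image) auto
  then obtain B where B: "\<And>x. x \<in> cball 0 R \<Longrightarrow> norm (f x) \<le> B"
    by (force dest!: compact_imp_bounded simp: bounded_iff)
  show ?thesis
  proof (rule integrableI_bounded_set)
    show "f \<in> borel_measurable lborel"
      using borel_measurable_continuous_onI[OF assms(1)] by simp
    show "emeasure lborel (cball 0 R :: 'a set) < \<infinity>"
      using emeasure_lborel_cball_finite .
  qed (use assms B in auto)
qed

lemma integral_lborel_translate:
  fixes f :: "'a::euclidean_space \<Rightarrow> real"
  assumes "f \<in> borel_measurable borel"
  shows "(LINT x|lborel. f (x + a)) = (LINT x|lborel. f x)"
proof -
  have "(LINT x|lborel. f x) = (LINT x|distr lborel borel ((+) a). f x)"
    by (simp add: lborel_distr_plus)
  also have "\<dots> = (LINT x|lborel. f (a + x))"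
    using assms by (subst integral_distr) auto
  finally show ?thesis by (simp add: add.commute)
qed

text \<open>By translation invariance the difference quotients integrate to 0.\<close>

lemma integral_partial_deriv_eq_0:
  fixes f :: "real ^ 'n::finite \<Rightarrow> real"
  assumes diff: "\<And>x. f differentiable (at x)"
    and cont: "continuous_on UNIV (partial_deriv i f)"
    and supp: "\<And>x. R < norm x \<Longrightarrow> f x = 0"
  shows "(LINT x|lborel. partial_deriv i f x) = 0"
proof -
  define a :: "real ^ 'n" where "a = axis i 1"
  have norm_a: "norm a = 1" by (simp add: a_def)
  define h :: "nat \<Rightarrow> real" where "h k = 1 / Suc k" for k
  have h: "0 < h k" "h k \<le> 1" for k by (auto simp: h_def)
  have h0: "h \<longlonglongrightarrow> 0" unfolding h_def by (rule LIMSEQ_Suc[OF lim_1_over_n])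
  define q where "q k x = (f (x + h k *\<^sub>R a) - f x) / h k" for k x
  have cf: "continuous_on UNIV f"
    by (intro continuous_at_imp_continuous_on ballI differentiable_imp_continuous_within diff)
  have [measurable]: "f \<in> borel_measurable borel"
    using borel_measurable_continuous_onI[OF cf] .
  have [measurable]: "partial_deriv i f \<in> borel_measurable borel"
    using borel_measurable_continuous_onI[OF cont] .
  have line: "((\<lambda>t. f (x + t *\<^sub>R a)) has_real_derivative partial_deriv i f (x + t *\<^sub>R a)) (at t)"
    for x t
  proof -
    have D: "(f has_derivative frechet_derivative f (at (x + t *\<^sub>R a))) (at (x + t *\<^sub>R a))"
      using diff frechet_derivative_works by blast
    have "((\<lambda>t. f (x + t *\<^sub>R a)) has_derivative
        (\<lambda>s. frechet_derivative f (at (x + t *\<^sub>R a)) (s *\<^sub>R a))) (at t)"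
      by (rule has_derivative_compose[where f = "\<lambda>t. x + t *\<^sub>R a", OF _ D])
        (auto intro!: derivative_eq_intros)
    moreover have "(\<lambda>s. frechet_derivative f (at (x + t *\<^sub>R a)) (s *\<^sub>R a)) =
        (*) (partial_deriv i f (x + t *\<^sub>R a))"
      using linear_cmul[OF has_derivative_linear[OF D]]
      by (auto simp: partial_deriv_def a_def mult.commute)
    ultimately show ?thesis by (simp add: has_field_derivative_def)
  qed
  have "partial_deriv i f x = 0" if "R < norm x" for x
    by (rule partial_deriv_eq_0[of "- cball 0 R"]) (use that supp in auto)
  have "compact (partial_deriv i f ` cball 0 (R + 1))"
    by (intro compact_continuous_image continuous_on_subset[OF cont]) auto
  then obtain B where B: "\<And>x. x \<in> cball 0 (R + 1) \<Longrightarrow> \<bar>partial_deriv i f x\<bar> \<le> B"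
    by (force dest!: compact_imp_bounded simp: bounded_iff)
  \<comment> \<open>For negative R + 1 the ball is empty and B may be negative, hence the maximum
    with 0.\<close>
  have B': "\<bar>partial_deriv i f x\<bar> \<le> max B 0" for x
  proof (cases "norm x \<le> R")
    case True
    then show ?thesis using B[of x] by auto
  next
    case False
    then show ?thesis using \<open>\<And>x. R < norm x \<Longrightarrow> partial_deriv i f x = 0\<close>[of x] by auto
  qed
  \<comment> \<open>Inside the ball the mean value theorem turns the quotient into a partial
    derivative at an intermediate point. Outside it, \<open>h k\<close> \<le> 1 keeps both end
    points beyond radius R, so the quotient is 0. The bound is thus uniform in k.\<close>
  have bound: "norm (q k x) \<le> max B 0 * indicator (cball 0 (R + 1)) x" for k x
  proof (cases "x \<in> cball 0 (R + 1)")
    case True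
    obtain z where "f (x + h k *\<^sub>R a) - f (x + 0 *\<^sub>R a) =
        (h k - 0) * partial_deriv i f (x + z *\<^sub>R a)"
      using MVT2[OF h(1)[of k] line[of x]] by auto
    then have "q k x = partial_deriv i f (x + z *\<^sub>R a)"
      using h(1)[of k] by (simp add: q_def field_simps)
    then show ?thesis using True B' by simp
  next
    case False
    have "norm x \<le> norm (x + h k *\<^sub>R a) + norm (h k *\<^sub>R a)"
      using norm_triangle_ineq4[of "x + h k *\<^sub>R a" "h k *\<^sub>R a"] by simp
    moreover have "norm (h k *\<^sub>R a) \<le> 1"
      using h[of k] norm_a by simp
    ultimately have "R < norm (x + h k *\<^sub>R a)" "R < norm x"
      using False by auto
    then show ?thesis using supp by (simp add: q_def)
  qed
  have "(\<lambda>k. LINT x|lborel. q k x) \<longlonglongrightarrow> (LINT x|lborel. partial_deriv i f x)"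
  proof (rule integral_dominated_convergence)
    show "integrable lborel (\<lambda>x :: real ^ 'n. max B 0 * indicator (cball 0 (R + 1)) x)"
      using emeasure_lborel_cball_finite by (intro integrable_mult_right integrable_real_indicator) auto
    show "AE x in lborel. (\<lambda>k. q k x) \<longlonglongrightarrow> partial_deriv i f x"
    proof (rule AE_I2)
      fix x :: "real ^ 'n"
      have "((\<lambda>s. (f (x + s *\<^sub>R a) - f x) / s) \<longlongrightarrow> partial_deriv i f x) (at 0)"
        using line[of x 0] by (simp add: has_field_derivative_iff)
      moreover have "filterlim h (at 0) sequentially"
        using h0 less_imp_neq[OF h(1), symmetric] by (auto simp: filterlim_at)
      ultimately show "(\<lambda>k. q k x) \<longlonglongrightarrow> partial_deriv i f x"
        unfolding q_def by (rule filterlim_compose)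
    qed
    show "AE x in lborel. norm (q k x) \<le> max B 0 * indicator (cball 0 (R + 1)) x" for k
      using bound by simp
  qed (simp_all add: q_def)
  moreover have "(LINT x|lborel. q k x) = 0" for k
  proof -
    have int: "integrable lborel f"
      by (rule integrable_lborel_continuous_bounded_support[OF cf supp])
    have "integrable lborel (\<lambda>x. f (x + h k *\<^sub>R a))"
    proof (rule integrable_lborel_continuous_bounded_support)
      show "continuous_on UNIV (\<lambda>x. f (x + h k *\<^sub>R a))"
        by (intro continuous_on_compose2[OF cf]) (auto intro!: continuous_intros)
      fix x :: "real ^ 'n" assume "R + 1 < norm x"
      moreover have "norm x \<le> norm (x + h k *\<^sub>R a) + norm (h k *\<^sub>R a)"
        using norm_triangle_ineq4[of "x + h k *\<^sub>R a" "h k *\<^sub>R a"] by simp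
      moreover have "norm (h k *\<^sub>R a) \<le> 1"
        using h[of k] norm_a by simp
      ultimately show "f (x + h k *\<^sub>R a) = 0" by (intro supp) linarith
    qed
    with int show ?thesis
      unfolding q_def by (simp add: integral_lborel_translate)
  qed
  ultimately show ?thesis
    by (simp add: LIMSEQ_const_iff)
qed

text \<open>The definitions integrate over \<open>lebesgue_on \<Omega>\<close>, whereas the
  translation argument lives on \<open>lborel\<close> over the whole space. This is the bridge for
  functions extended by zero.\<close>

lemma integral_lebesgue_on_eq_lborel:
  fixes f :: "'a::euclidean_space \<Rightarrow> real"
  assumes "\<Omega> \<in> sets lebesgue" "f \<in> borel_measurable borel" "\<And>x. x \<notin> \<Omega> \<Longrightarrow> f x = 0"
  shows "(LINT x|lebesgue_on \<Omega>. f x) = (LINT x|lborel. f x)"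
proof -
  have "(LINT x|lebesgue_on \<Omega>. f x) = (LINT x|lebesgue. indicator \<Omega> x *\<^sub>R f x)"
    using assms by (intro integral_restrict_space) auto
  also have "(\<lambda>x. indicator \<Omega> x *\<^sub>R f x) = f"
    using assms(3) by (auto simp: indicator_def fun_eq_iff)
  finally show ?thesis using assms(2) by (simp add: integral_completion)
qed

lemma test_fun_eq_0: "test_fun \<Omega> \<psi> \<Longrightarrow> x \<notin> \<Omega> \<Longrightarrow> \<psi> x = 0"
  unfolding test_fun_def using closure_subset[of "{x. \<psi> x \<noteq> 0}"] by auto

lemma test_fun_partial_deriv_eq_0:
  assumes "test_fun \<Omega> \<psi>" "x \<notin> \<Omega>"
  shows "partial_deriv i \<psi> x = 0"
  by (rule partial_deriv_eq_0[of "- closure {x. \<psi> x \<noteq> 0}"])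
    (use assms closure_subset[of "{x. \<psi> x \<noteq> 0}"] in \<open>auto simp: test_fun_def\<close>)

lemma test_fun_bounded_support:
  assumes "test_fun \<Omega> \<psi>"
  obtains R where "\<forall>x. R < norm x \<longrightarrow> \<psi> x = 0 \<and> (\<forall>i. partial_deriv i \<psi> x = 0)"
proof -
  let ?K = "closure {x. \<psi> x \<noteq> 0}"
  have "bounded ?K" using assms by (auto simp: test_fun_def compact_imp_bounded)
  then obtain R where R: "\<And>x. x \<in> ?K \<Longrightarrow> norm x \<le> R" unfolding bounded_iff by blast
  \<comment> \<open>Regarding \<psi> as a test function on a ball gives the vanishing of \<psi> and
    of all its partial derivatives outside that ball at once.\<close>
  have "test_fun (cball 0 R) \<psi>"
    using assms R by (auto simp: test_fun_def)
  then show ?thesis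
    by (intro that[of R]) (auto intro: test_fun_eq_0 test_fun_partial_deriv_eq_0)
qed

lemma test_fun_continuous: "test_fun \<Omega> \<psi> \<Longrightarrow> continuous_on S \<psi>"
  by (auto simp: test_fun_def intro!: continuous_at_imp_continuous_on
      differentiable_imp_continuous_within smooth_differentiable)

lemma test_fun_continuous_partial_deriv:
  "test_fun \<Omega> \<psi> \<Longrightarrow> continuous_on S (partial_deriv i \<psi>)"
  by (simp add: test_fun_def smooth_continuous_partial_deriv)

lemma integrable_mult_test_fun:
  assumes "\<Omega> \<in> sets lebesgue" "test_fun \<Omega> \<psi>" "continuous_on UNIV v"
  shows "integrable lborel (\<lambda>x. v x * \<psi> x)" "integrable lborel (\<lambda>x. v x * partial_deriv i \<psi> x)"
    "(LINT x|lebesgue_on \<Omega>. v x * \<psi> x) = (LINT x|lborel. v x * \<psi> x)"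
    "(LINT x|lebesgue_on \<Omega>. v x * partial_deriv i \<psi> x) = (LINT x|lborel. v x * partial_deriv i \<psi> x)"
proof -
  obtain R where R: "\<forall>x. R < norm x \<longrightarrow> \<psi> x = 0 \<and> (\<forall>i. partial_deriv i \<psi> x = 0)"
    using test_fun_bounded_support[OF assms(2)] .
  have c: "continuous_on UNIV (\<lambda>x. v x * \<psi> x)" "continuous_on UNIV (\<lambda>x. v x * partial_deriv i \<psi> x)"
    using assms by (auto intro!: continuous_intros test_fun_continuous[OF assms(2)]
        test_fun_continuous_partial_deriv[OF assms(2)])
  show "integrable lborel (\<lambda>x. v x * \<psi> x)" "integrable lborel (\<lambda>x. v x * partial_deriv i \<psi> x)"
    by (rule integrable_lborel_continuous_bounded_support; use c R in auto)+
  show "(LINT x|lebesgue_on \<Omega>. v x * \<psi> x) = (LINT x|lborel. v x * \<psi> x)"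
    by (rule integral_lebesgue_on_eq_lborel)
      (use assms c in \<open>auto intro!: borel_measurable_continuous_onI simp: test_fun_eq_0[OF assms(2)]\<close>)
  show "(LINT x|lebesgue_on \<Omega>. v x * partial_deriv i \<psi> x) = (LINT x|lborel. v x * partial_deriv i \<psi> x)"
    by (rule integral_lebesgue_on_eq_lborel)
      (use assms c in \<open>auto intro!: borel_measurable_continuous_onI simp: test_fun_partial_deriv_eq_0[OF assms(2)]\<close>)
qed

text \<open>The product of v and \<psi> has bounded support in the whole space, so its partial
  derivative integrates to 0 there. No boundary term of \<Omega> appears.\<close>

lemma integral_by_parts_test_fun:
  assumes \<Omega>: "\<Omega> \<in> sets lebesgue" and \<psi>: "test_fun \<Omega> \<psi>" and v: "smooth_vec v"
  shows "(LINT x|lebesgue_on \<Omega>. v x * partial_deriv i \<psi> x) =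
    - (LINT x|lebesgue_on \<Omega>. partial_deriv i v x * \<psi> x)"
proof -
  obtain R where R: "\<forall>x. R < norm x \<longrightarrow> \<psi> x = 0 \<and> (\<forall>i. partial_deriv i \<psi> x = 0)"
    using test_fun_bounded_support[OF \<psi>] .
  have cv: "continuous_on UNIV v" "continuous_on UNIV (partial_deriv i v)"
    using v by (auto intro: smooth_vec_continuous smooth_vec_partial_deriv)
  have d: "v differentiable (at x)" "\<psi> differentiable (at x)" for x
    using v \<psi> by (auto intro: smooth_vec_differentiable smooth_differentiable simp: test_fun_def)
  have eq: "partial_deriv i (\<lambda>x. v x * \<psi> x) = (\<lambda>x. v x * partial_deriv i \<psi> x + partial_deriv i v x * \<psi> x)"
    using d by (auto simp: partial_deriv_mult)
  have "(LINT x|lborel. partial_deriv i (\<lambda>x. v x * \<psi> x) x) = 0"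
  proof (rule integral_partial_deriv_eq_0)
    show "(\<lambda>x. v x * \<psi> x) differentiable (at x)" for x
      using d by (rule differentiable_mult)
    show "continuous_on UNIV (partial_deriv i (\<lambda>x. v x * \<psi> x))"
      unfolding eq using cv
      by (auto intro!: continuous_intros test_fun_continuous[OF \<psi>]
            test_fun_continuous_partial_deriv[OF \<psi>])
  qed (use R in auto)
  then show ?thesis
    unfolding eq using integrable_mult_test_fun[OF \<Omega> \<psi>] cv by simp
qed

section \<open>Smooth functions positive exactly on an open set\<close>

lemma grad_nth [simp]: "grad f x $ i = partial_deriv i f x"
  by (simp add: grad_def)

lemma continuous_on_grad:
  assumes "smooth_vec u"
  shows "continuous_on S (grad u)"
  unfolding grad_def
  by (intro continuous_on_vec_lambda smooth_vec_continuous smooth_vec_partial_deriv assms)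

lemma locally_integrable_continuous:
  assumes "continuous_on UNIV f"
  shows "locally_integrable \<Omega> f"
  unfolding locally_integrable_def
proof (intro allI impI)
  fix K assume "compact K \<and> K \<subseteq> \<Omega>"
  then have "integrable lborel (\<lambda>x. indicator K x *\<^sub>R f x)"
    using assms continuous_on_subset by (intro borel_integrable_compact) auto
  then show "f absolutely_integrable_on K"
    unfolding set_integrable_def
    by (subst integrable_completion) (auto dest: borel_measurable_integrable)
qed

lemma in_Lp_bounded:
  assumes "finite_measure M" "f \<in> borel_measurable M" "\<And>x. x \<in> space M \<Longrightarrow> norm (f x) \<le> C"
    and p: "0 < p"
  shows "in_Lp M p f"
proof -
  have "norm (norm (f x) powr p) \<le> C powr p" if "x \<in> space M" for x
    using assms(3)[OF that] p by (simp add: powr_mono2)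
  then have "integrable M (\<lambda>x. norm (f x) powr p)"
    using assms(2) by (intro finite_measure.integrable_const_bound[OF assms(1)]) auto
  with assms(2) show ?thesis by (simp add: in_Lp_def)
qed

text \<open>Dominated convergence: the constant \<open>C powr p\<close> is integrable because the
  measure is finite.\<close>

lemma Lp_norm_tendsto_0_bounded:
  assumes "finite_measure M" "\<And>k. f k \<in> borel_measurable M"
    and bound: "\<And>k x. x \<in> space M \<Longrightarrow> norm (f k x) \<le> C"
    and lim: "\<And>x. x \<in> space M \<Longrightarrow> (\<lambda>k. f k x) \<longlonglongrightarrow> 0"
    and p: "0 < p"
  shows "(\<lambda>k. Lp_norm M p (f k)) \<longlonglongrightarrow> 0"
proof -
  have "(\<lambda>k. LINT x|M. norm (f k x) powr p) \<longlonglongrightarrow> (LINT x|M. 0)"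
  proof (rule integral_dominated_convergence)
    show "integrable M (\<lambda>x. C powr p)"
      by (rule finite_measure.integrable_const[OF assms(1)])
    show "AE x in M. (\<lambda>k. norm (f k x) powr p) \<longlonglongrightarrow> 0"
      using p by (intro AE_I2 tendsto_zero_powrI tendsto_norm_zero lim) auto
    show "AE x in M. norm (norm (f k x) powr p) \<le> C powr p" for k
      using p by (intro AE_I2) (simp add: bound powr_mono2)
  qed (use assms(2) in auto)
  then show ?thesis
    unfolding Lp_norm_def using p
    by (intro tendsto_zero_powrI[OF _ tendsto_const]) auto
qed

lemma has_weak_grad_smooth_vec:
  assumes "\<Omega> \<in> sets lebesgue" "smooth_vec u"
  shows "has_weak_grad \<Omega> u (grad u)"
  unfolding has_weak_grad_def
  by (auto intro!: locally_integrable_continuous smooth_vec_continuous continuous_on_grad assms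
      simp: integral_by_parts_test_fun[OF assms(1) _ assms(2)])

text \<open>The pointwise equation is tested coordinate by coordinate, each partial derivative of u
  being the smooth factor in an integration by parts. Nothing is assumed about V alone: on \<Omega>
  the product V u equals minus the Laplacian, which is continuous on the whole space, and this gives
  local integrability.\<close>

lemma distributional_solution_smooth_vec:
  assumes \<Omega>: "\<Omega> \<in> sets lebesgue" and u: "smooth_vec u"
    and eq: "\<And>x. x \<in> \<Omega> \<Longrightarrow> - (\<Sum>i\<in>UNIV. partial_deriv i (partial_deriv i u) x) = V x * u x"
  shows "distributional_solution \<Omega> V u"
proof -
  let ?L = "\<lambda>x. \<Sum>i\<in>UNIV. partial_deriv i (partial_deriv i u) x"
  have L: "smooth_vec ?L"
    by (intro smooth_vec_sum smooth_vec_partial_deriv u) simp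
  have "locally_integrable \<Omega> (\<lambda>x. - ?L x)"
    by (intro locally_integrable_continuous continuous_on_minus smooth_vec_continuous L)
  then have loc: "locally_integrable \<Omega> (\<lambda>x. V x * u x)"
    unfolding locally_integrable_def
    by (smt (verit, best) eq set_integrable_cong subsetD)
  have "(LINT x|lebesgue_on \<Omega>. grad u x \<bullet> grad \<psi> x) = (LINT x|lebesgue_on \<Omega>. V x * u x * \<psi> x)"
    if \<psi>: "test_fun \<Omega> \<psi>" for \<psi>
  proof -
    have cont: "continuous_on UNIV (partial_deriv i u)"
      "continuous_on UNIV (partial_deriv i (partial_deriv i u))" for i
      by (intro smooth_vec_continuous smooth_vec_partial_deriv u)+
    have int: "integrable (lebesgue_on \<Omega>) (\<lambda>x. v x * \<psi> x)"
      "integrable (lebesgue_on \<Omega>) (\<lambda>x. v x * partial_deriv i \<psi> x)"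
      if v: "continuous_on UNIV v" for v i
    proof -
      have "integrable lborel (\<lambda>x. v x * \<psi> x)" "integrable lborel (\<lambda>x. v x * partial_deriv i \<psi> x)"
        using integrable_mult_test_fun[OF \<Omega> \<psi> v] by auto
      then show "integrable (lebesgue_on \<Omega>) (\<lambda>x. v x * \<psi> x)"
        "integrable (lebesgue_on \<Omega>) (\<lambda>x. v x * partial_deriv i \<psi> x)"
        using \<Omega> by (auto simp: integrable_restrict_space integrable_completion
            simp del: real_scaleR_def intro!: integrable_mult_indicator dest: borel_measurable_integrable)
    qed
    have "(LINT x|lebesgue_on \<Omega>. grad u x \<bullet> grad \<psi> x) =
        (\<Sum>i\<in>UNIV. LINT x|lebesgue_on \<Omega>. partial_deriv i u x * partial_deriv i \<psi> x)"
      unfolding inner_vec_def grad_nth inner_real_def by (intro Bochner_Integration.integral_sum int cont)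
    also have "\<dots> = (\<Sum>i\<in>UNIV. - (LINT x|lebesgue_on \<Omega>. partial_deriv i (partial_deriv i u) x * \<psi> x))"
      by (intro sum.cong refl integral_by_parts_test_fun \<Omega> \<psi> smooth_vec_partial_deriv u)
    also have "\<dots> = - (LINT x|lebesgue_on \<Omega>. ?L x * \<psi> x)"
      unfolding sum_distrib_right sum_negf
      by (subst Bochner_Integration.integral_sum) (auto intro: int cont)
    also have "\<dots> = (LINT x|lebesgue_on \<Omega>. - ?L x * \<psi> x)"
      by simp
    also have "\<dots> = (LINT x|lebesgue_on \<Omega>. V x * u x * \<psi> x)"
      using eq by (intro Bochner_Integration.integral_cong refl) auto
    finally show ?thesis .
  qed
  with loc has_weak_grad_smooth_vec[OF \<Omega> u] show ?thesis
    unfolding distributional_solution_def by blast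
qed

lemma flat_powr_1_bounds: "0 \<le> flat_powr 1 s" "flat_powr 1 s \<le> max s 0"
proof -
  have "s * exp (- 1 / s) \<le> s * 1" if "0 < s"
    using that by (intro mult_left_mono) auto
  then show "0 \<le> flat_powr 1 s" "flat_powr 1 s \<le> max s 0"
    by (auto simp: flat_powr_def)
qed

text \<open>The sum is the derivative of \<open>flat_powr 1\<close>. With y = 1 / s the upper bound
  is the inequality 1 + y \<le> exp y.\<close>

lemma flat_powr_1_derivative_bounds:
  "0 \<le> flat_powr 0 s + flat_powr (- 1) s" "flat_powr 0 s + flat_powr (- 1) s \<le> 1"
proof -
  have "(1 + 1 / s) * exp (- 1 / s) \<le> exp (1 / s) * exp (- 1 / s)" if "0 < s"
    by (intro mult_right_mono exp_ge_add_one_self) auto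
  then have "(1 + 1 / s) * exp (- 1 / s) \<le> 1" if "0 < s"
    using that by (simp flip: exp_add)
  then show "0 \<le> flat_powr 0 s + flat_powr (- 1) s" "flat_powr 0 s + flat_powr (- 1) s \<le> 1"
    by (auto simp: flat_powr_def powr_minus field_simps)
qed

text \<open>
  The approximating test functions are \<open>h\<^sub>d \<circ> u\<close> with \<open>h\<^sub>d t = (t - d) exp (- d / (t - d))\<close> for
  \<open>t > d\<close> and \<open>h\<^sub>d t = 0\<close> otherwise, since \<open>0 \<le> h\<^sub>d' \<le> 1\<close>.
\<close>

lemma in_W012_smooth_vec:
  assumes \<Omega>: "open \<Omega>" "bounded \<Omega>" and u: "smooth_vec u"
    and pos: "\<And>x. x \<in> \<Omega> \<Longrightarrow> 0 < u x" and nonpos: "\<And>x. x \<notin> \<Omega> \<Longrightarrow> u x \<le> 0"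
  shows "in_W012 \<Omega> u"
proof -
  have \<Omega>L: "\<Omega> \<in> sets lebesgue" using \<Omega>(1) by simp
  have fin: "finite_measure (lebesgue_on \<Omega>)"
    using \<Omega> by (intro finite_measure_lebesgue_on) (simp add: bounded_set_imp_lmeasurable)
  have meas: "f \<in> borel_measurable (lebesgue_on \<Omega>)" if "continuous_on UNIV f"
    for f :: "real ^ 'a \<Rightarrow> 'c::euclidean_space"
    by (rule continuous_imp_measurable_on_sets_lebesgue[OF continuous_on_subset[OF that] \<Omega>L]) simp
  have bdd: "\<exists>C. \<forall>x\<in>\<Omega>. norm (f x) \<le> C" if "continuous_on UNIV f"
    for f :: "real ^ 'a \<Rightarrow> 'c::euclidean_space"
  proof -
    have "compact (f ` closure \<Omega>)"
      by (intro compact_continuous_image continuous_on_subset[OF that])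
        (simp_all add: \<Omega> compact_closure)
    then obtain C where "\<forall>y \<in> f ` closure \<Omega>. norm y \<le> C"
      using compact_imp_bounded bounded_iff by blast
    then show ?thesis using closure_subset by blast
  qed
  have cu: "continuous_on UNIV u" "continuous_on UNIV (grad u)"
    using u by (simp_all add: smooth_vec_continuous continuous_on_grad)
  obtain C where C: "\<And>x. x \<in> \<Omega> \<Longrightarrow> norm (u x) \<le> C" using bdd[OF cu(1)] by blast
  obtain C' where C': "\<And>x. x \<in> \<Omega> \<Longrightarrow> norm (grad u x) \<le> C'" using bdd[OF cu(2)] by blast

  define d :: "nat \<Rightarrow> real" where "d k = 1 / Suc k" for k
  have d: "0 < d k" for k by (simp add: d_def)
  \<comment> \<open>This is the truncation announced above with d = \<open>d k\<close>, written as a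
    rescaling of the single function \<open>flat_powr 1\<close>. Such a rescaling leaves the range
    of the derivative unchanged, so the bounds 0 and 1 hold for all k.\<close>
  define h where "h k t = d k * flat_powr 1 (t / d k - 1)" for k t
  define h' where "h' k t = flat_powr 0 (t / d k - 1) + flat_powr (- 1) (t / d k - 1)" for k t
  define \<phi> where "\<phi> k x = h k (u x)" for k x
  have h_deriv: "(h k has_real_derivative h' k t) (at t)" for k t
    unfolding h_def h'_def using d[of k]
    by (auto intro!: derivative_eq_intros DERIV_chain2[OF flat_powr_has_derivative] simp: field_simps)
  have h_smooth: "smooth_real (h k)" for k
  proof -
    have "smooth_real (\<lambda>t. inverse (d k) * t + (- 1))"
      by (intro smooth_real.add smooth_real.mult smooth_real.const smooth_real.ident)
    then have "smooth_real (\<lambda>t. d k * flat_powr 1 (inverse (d k) * t + (- 1)))"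
      by (rule smooth_real.mult[OF smooth_real.const smooth_real.comp[OF _ smooth_real.flat]])
    then show ?thesis by (simp add: h_def[abs_def] divide_inverse mult.commute)
  qed
  have \<phi>_smooth: "smooth_vec (\<phi> k)" for k
    unfolding \<phi>_def[abs_def] by (rule smooth_vec.comp[OF u h_smooth])
  have \<phi>_test: "test_fun \<Omega> (\<phi> k)" for k
  proof -
    \<comment> \<open>A superlevel set at positive height is closed in the whole space and, by the
      sign of u off \<Omega>, contained in the bounded set \<Omega>. Hence it is a compact set
      containing the support.\<close>
    let ?K = "{x. d k \<le> u x}"
    have "?K \<subseteq> \<Omega>" using nonpos d[of k] by (force simp: not_le)
    moreover have "closed ?K" by (intro closed_Collect_le cu continuous_intros)
    ultimately have K: "compact ?K" "?K \<subseteq> \<Omega>"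
      using \<Omega>(2) bounded_subset compact_eq_bounded_closed by blast+
    have "{x. \<phi> k x \<noteq> 0} \<subseteq> ?K"
      using d[of k] by (auto simp: \<phi>_def h_def flat_powr_def field_simps split: if_splits)
    then have "closure {x. \<phi> k x \<noteq> 0} \<subseteq> ?K"
      using K by (intro closure_minimal) (auto simp: compact_imp_closed)
    then show ?thesis
      using K smooth_vec_imp_smooth[OF \<phi>_smooth] unfolding test_fun_def
      by (meson closed_closure closed_subset compact_closure compact_eq_bounded_closed bounded_subset
          order_trans)
  qed
  \<comment> \<open>The scalar factor is at most 1 in absolute value and tends to 0 wherever u is
    positive, so the bound of \<open>grad u\<close> dominates the sequence.\<close>
  have grad_\<phi>: "grad (\<phi> k) x - grad u x = (h' k (u x) - 1) *\<^sub>R grad u x" for k x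
    using partial_deriv_comp[OF smooth_vec_differentiable[OF u] h_deriv]
    by (simp add: vec_eq_iff \<phi>_def[abs_def] algebra_simps)
  have h_lim: "(\<lambda>k. h k t) \<longlonglongrightarrow> t" and h'_lim: "(\<lambda>k. h' k t) \<longlonglongrightarrow> 1" if t: "0 < t" for t
  proof -
    \<comment> \<open>The quantity is \<open>t / d k - 1\<close>. Once it is positive, only the
      first branch of \<open>flat_powr\<close> is in play and both limits concern explicit
      expressions.\<close>
    have "\<forall>\<^sub>F k in sequentially. t * real (Suc k) - 1 > 0"
      using t by real_asymp
    then have ev: "\<forall>\<^sub>F k in sequentially. (t * real (Suc k) - 1) * exp (- 1 / (t * real (Suc k) - 1)) / real (Suc k) = h k t"
      "\<forall>\<^sub>F k in sequentially. (1 + 1 / (t * real (Suc k) - 1)) * exp (- 1 / (t * real (Suc k) - 1)) = h' k t"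
      by (eventually_elim, simp add: h_def h'_def d_def flat_powr_def powr_minus field_simps)+
    have "(\<lambda>k. (t * real (Suc k) - 1) * exp (- 1 / (t * real (Suc k) - 1)) / real (Suc k)) \<longlonglongrightarrow> t"
      using t by real_asymp
    then show "(\<lambda>k. h k t) \<longlonglongrightarrow> t" using ev(1) by (rule Lim_transform_eventually)
    have "(\<lambda>k. (1 + 1 / (t * real (Suc k) - 1)) * exp (- 1 / (t * real (Suc k) - 1))) \<longlonglongrightarrow> 1"
      using t by real_asymp
    then show "(\<lambda>k. h' k t) \<longlonglongrightarrow> 1" using ev(2) by (rule Lim_transform_eventually)
  qed
  have "(\<lambda>k. Lp_norm (lebesgue_on \<Omega>) 2 (\<lambda>x. grad (\<phi> k) x - grad u x)) \<longlonglongrightarrow> 0"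
  proof (rule Lp_norm_tendsto_0_bounded[OF fin])
    show "(\<lambda>x. grad (\<phi> k) x - grad u x) \<in> borel_measurable (lebesgue_on \<Omega>)" for k
      by (intro meas continuous_on_diff continuous_on_grad \<phi>_smooth u)
    fix x assume "x \<in> space (lebesgue_on \<Omega>)"
    then have x: "x \<in> \<Omega>" by simp
    show "norm (grad (\<phi> k) x - grad u x) \<le> C'" for k
    proof -
      have "\<bar>h' k (u x) - 1\<bar> \<le> 1"
        unfolding h'_def using flat_powr_1_derivative_bounds[of "u x / d k - 1"] by linarith
      then have "\<bar>h' k (u x) - 1\<bar> * norm (grad u x) \<le> 1 * C'"
        by (intro mult_mono C' x) auto
      then show ?thesis by (simp add: grad_\<phi>)
    qed
    have "(\<lambda>k. (h' k (u x) - 1) *\<^sub>R grad u x) \<longlonglongrightarrow> (1 - 1) *\<^sub>R grad u x"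
      by (intro tendsto_intros h'_lim pos x)
    then show "(\<lambda>k. grad (\<phi> k) x - grad u x) \<longlonglongrightarrow> 0" by (simp add: grad_\<phi>)
  qed simp
  moreover have "(\<lambda>k. Lp_norm (lebesgue_on \<Omega>) 2 (\<lambda>x. \<phi> k x - u x)) \<longlonglongrightarrow> 0"
  proof (rule Lp_norm_tendsto_0_bounded[OF fin])
    show "(\<lambda>x. \<phi> k x - u x) \<in> borel_measurable (lebesgue_on \<Omega>)" for k
      by (intro meas continuous_on_diff cu smooth_vec_continuous \<phi>_smooth)
    fix x assume "x \<in> space (lebesgue_on \<Omega>)"
    then have x: "x \<in> \<Omega>" by simp
    show "norm (\<phi> k x - u x) \<le> C" for k
    proof -
      have "d k * flat_powr 1 (u x / d k - 1) \<le> d k * max (u x / d k - 1) 0"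
        using d[of k] by (intro mult_left_mono flat_powr_1_bounds) auto
      also have "\<dots> \<le> u x"
        using d[of k] pos[OF x] by (auto simp: max_def field_simps)
      finally have "\<phi> k x \<le> u x" by (simp add: \<phi>_def h_def)
      moreover have "0 \<le> \<phi> k x"
        using d[of k] flat_powr_1_bounds(1) by (simp add: \<phi>_def h_def)
      ultimately show ?thesis using C[OF x] by auto
    qed
    show "(\<lambda>k. \<phi> k x - u x) \<longlonglongrightarrow> 0"
      using h_lim[OF pos[OF x]] unfolding \<phi>_def by (rule LIM_zero)
  qed simp
  moreover have "in_Lp (lebesgue_on \<Omega>) 2 u" "in_Lp (lebesgue_on \<Omega>) 2 (grad u)"
    by (rule in_Lp_bounded[OF fin meas]; use cu C C' in auto)+
  ultimately show ?thesis
    unfolding in_W012_def using has_weak_grad_smooth_vec[OF \<Omega>L u] \<phi>_test by blast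
qed

section \<open>Radial functions and the convex smoothing\<close>

lemma partial_deriv_radial:
  fixes x :: "real ^ 'n::finite"
  assumes "(F has_real_derivative p) (at (x \<bullet> x))"
  shows "partial_deriv i (\<lambda>x. F (x \<bullet> x)) x = p * (2 * x $ i)"
  using partial_deriv_comp[OF smooth_vec_differentiable[OF smooth_vec_inner_self] assms]
  by (simp add: partial_deriv_inner_self)

text \<open>Here p and p' are derivatives in the squared radius. The second derivative in direction
  i is 2 p plus 4 p' times the squared coordinate, and summation turns the squares into the inner
  product.\<close>

lemma laplacian_radial:
  fixes x :: "real ^ 'n::finite"
  assumes F: "\<And>s. (F has_real_derivative p s) (at s)" and p: "\<And>s. (p has_real_derivative p' s) (at s)"
  shows "(\<Sum>i\<in>UNIV. partial_deriv i (partial_deriv i (\<lambda>x :: real ^ 'n. F (x \<bullet> x))) x) =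
    2 * real CARD('n) * p (x \<bullet> x) + 4 * (x \<bullet> x) * p' (x \<bullet> x)"
proof -
  have 1: "partial_deriv i (\<lambda>x :: real ^ 'n. F (x \<bullet> x)) = (\<lambda>x. p (x \<bullet> x) * (2 * x $ i))" for i
    using F by (auto simp: partial_deriv_radial)
  have d: "(\<lambda>x :: real ^ 'n. x $ i) differentiable (at x)"
    "(\<lambda>x :: real ^ 'n. p (x \<bullet> x)) differentiable (at x)" for i
  proof -
    show "(\<lambda>x :: real ^ 'n. x $ i) differentiable (at x)"
      by (rule smooth_vec_differentiable[OF smooth_vec.coord])
    have "((\<lambda>x :: real ^ 'n. x \<bullet> x) has_derivative frechet_derivative (\<lambda>x. x \<bullet> x) (at x)) (at x)"
      using smooth_vec_differentiable[OF smooth_vec_inner_self] frechet_derivative_works by blast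
    from has_derivative_compose[OF this p[unfolded has_field_derivative_def]]
    show "(\<lambda>x :: real ^ 'n. p (x \<bullet> x)) differentiable (at x)"
      unfolding differentiable_def by blast
  qed
  have "((\<lambda>t. 2 * t) has_real_derivative 2) (at t)" for t :: real
    by (auto intro!: derivative_eq_intros)
  then have 2: "partial_deriv i (\<lambda>x :: real ^ 'n. 2 * x $ i) x = 2" for i
    using partial_deriv_comp[OF d(1), of "\<lambda>t. 2 * t" 2] by (simp add: partial_deriv_coord)
  have "partial_deriv i (partial_deriv i (\<lambda>x :: real ^ 'n. F (x \<bullet> x))) x =
      2 * p (x \<bullet> x) + 4 * p' (x \<bullet> x) * (x $ i * x $ i)" for i
    unfolding 1 using d p
    by (subst partial_deriv_mult) (auto simp: 2 partial_deriv_radial[OF p] intro!: differentiable_mult)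
  then show ?thesis
    by (simp add: sum.distrib inner_vec_def sum_distrib_left mult_ac)
qed

lemma real_antiderivative_exists:
  fixes f :: "real \<Rightarrow> real"
  assumes "\<And>x. isCont f x"
  obtains F where "\<And>x. (F has_real_derivative f x) (at x)" "F a = b"
proof -
  obtain F where "\<And>x. (F has_real_derivative f x) (at x)"
    using einterval_antiderivative[of "-\<infinity>" "\<infinity>" f] assms
    by (auto simp: has_real_derivative_iff_has_vector_derivative)
  then show ?thesis
    by (intro that[of "\<lambda>x. F x - F a + b"]) (auto intro!: derivative_eq_intros)
qed

lemma smooth_real_isCont: "smooth_real f \<Longrightarrow> isCont f t"
  using smooth_real_derivative DERIV_isCont by blast

text \<open>
  The convex smoothing of \<open>max t 0\<close>: its second derivative is a bump function on \<open>[0, 1]\<close>,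
  and \<open>Q t - t * P t\<close> is the value at 0 of the tangent at \<open>t\<close>.
\<close>

lemma convex_smoothing_exists:
  obtains Q P :: "real \<Rightarrow> real" where
    "smooth_real Q" "\<And>t. (Q has_real_derivative P t) (at t)" "\<And>t. 1 \<le> t \<Longrightarrow> Q t = t"
    "0 < Q 0" "\<And>t. Q 0 \<le> Q t"
    "\<And>t. 0 \<le> t \<Longrightarrow> 0 \<le> Q t - t * P t" "\<And>t. 0 \<le> t \<Longrightarrow> Q t - t * P t \<le> 1"
    "\<And>t. 1 \<le> t \<Longrightarrow> Q t - t * P t = 0"
proof -
  \<comment> \<open>An unnormalised second derivative of Q, positive exactly on the open unit
    interval. The spelling \<open>1 + (- 1) * t\<close> matches the constructors of
    \<open>smooth_real\<close>.\<close>
  define w where "w t = flat_powr 0 t * flat_powr 0 (1 + (- 1) * t)" for t :: real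
  have w_smooth: "smooth_real w"
    unfolding w_def[abs_def]
    by (rule smooth_real.mult[OF smooth_real.flat smooth_real.comp[OF _ smooth_real.flat]])
      (intro smooth_real.add smooth_real.mult smooth_real.const smooth_real.ident)
  have w0: "0 \<le> w t" for t by (simp add: w_def flat_powr_def)
  have w_pos: "0 < w t" if "0 < t" "t < 1" for t using that by (simp add: w_def flat_powr_def)
  have w_eq_0: "w t = 0" if "t \<le> 0 \<or> 1 \<le> t" for t using that by (auto simp: w_def flat_powr_def)
  obtain R where R: "\<And>t. (R has_real_derivative w t) (at t)" and R0: "R 0 = 0"
    using real_antiderivative_exists[OF smooth_real_isCont[OF w_smooth], of 0 0] by auto
  have R_less: "R t < R 1" if t: "0 \<le> t" "t < 1" for t
  proof -
    obtain z where z: "t < z" "z < 1" "R 1 - R t = (1 - t) * w z"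
      using MVT2[OF t(2) R] by auto
    then have "0 < (1 - t) * w z" using t w_pos[of z] by simp
    with z(3) show ?thesis by simp
  qed
  have R1: "0 < R 1" using R_less[of 0] R0 by simp
  have R_mono: "R s \<le> R t" if "s \<le> t" for s t
    using DERIV_nonneg_imp_nondecreasing[OF that, of R] R w0 by blast
  have R_const1: "R t = R 1" if t: "1 \<le> t" for t
  proof (cases "t = 1")
    case False
    with t obtain z where "1 < z" "R t - R 1 = (t - 1) * w z" using MVT2[OF _ R, of 1 t] by auto
    then show ?thesis by (simp add: w_eq_0)
  qed simp
  have R_const0: "R t = 0" if t: "t \<le> 0" for t
  proof (cases "t = 0")
    case False
    with t obtain z where "z < 0" "R 0 - R t = (0 - t) * w z" using MVT2[OF _ R, of t 0] by auto
    then show ?thesis by (simp add: w_eq_0 R0)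
  qed (simp add: R0)
  \<comment> \<open>Division by \<open>R 1\<close> makes the slope rise from 0 to exactly 1.
    Together with the normalisation \<open>Q 1 = 1\<close> below, this makes Q the identity from 1
    on.\<close>
  define P where "P t = inverse (R 1) * R t" for t
  have P_deriv: "(P has_real_derivative inverse (R 1) * w t) (at t)" for t
    unfolding P_def[abs_def] using R by (intro DERIV_cmult)
  have R_smooth: "smooth_real R" by (rule smooth_real.antideriv[OF w_smooth R])
  have P_smooth: "smooth_real P"
    unfolding P_def[abs_def] by (rule smooth_real.mult[OF smooth_real.const R_smooth])
  have P0: "0 \<le> P t" for t
    using R1 R_mono[of 0 t] R_const0[of t] R0 by (cases "0 \<le> t") (auto simp: P_def)
  have P1: "P t = 1" if "1 \<le> t" for t using R_const1[OF that] R1 by (simp add: P_def)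
  have P_less: "P t < 1" if "0 \<le> t" "t < 1" for t
    using R_less[OF that] R1 by (simp add: P_def field_simps)
  have P_eq_0: "P t = 0" if "t \<le> 0" for t using R_const0[OF that] by (simp add: P_def)
  obtain Q where Q: "\<And>t. (Q has_real_derivative P t) (at t)" and Q1: "Q 1 = 1"
    using real_antiderivative_exists[OF smooth_real_isCont[OF P_smooth], of 1 1] by auto
  have Q_mono: "Q s \<le> Q t" if "s \<le> t" for s t
    using DERIV_nonneg_imp_nondecreasing[OF that, of Q] Q P0 by blast
  have Q_id: "Q t = t" if t: "1 \<le> t" for t
  proof (cases "t = 1")
    case False
    with t obtain z where "1 < z" "Q t - Q 1 = (t - 1) * P z" using MVT2[OF _ Q, of 1 t] by auto
    then show ?thesis by (simp add: P1 Q1)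
  qed (simp add: Q1)
  \<comment> \<open>By the mean value theorem Q grows over the unit interval by a slope strictly
    below 1, so it must start above 0.\<close>
  have Q0: "0 < Q 0"
  proof -
    obtain z where "0 < z" "z < 1" "Q 1 - Q 0 = (1 - 0) * P z" using MVT2[OF _ Q, of 0 1] by auto
    with P_less[of z] Q1 show ?thesis by simp
  qed
  \<comment> \<open>Left of 0 the slope vanishes and Q is constant. A positive lower bound on the
    whole line is needed because powers of q are taken at every real argument.\<close>
  have Q_ge: "Q 0 \<le> Q t" for t
  proof (cases "0 \<le> t")
    case False
    then obtain z where "z < 0" "Q 0 - Q t = (0 - t) * P z" using MVT2[OF _ Q, of t 0] by auto
    then show ?thesis by (simp add: P_eq_0)
  qed (rule Q_mono)
  have tangent_eq_0: "Q t - t * P t = 0" if "1 \<le> t" for t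
    using that by (simp add: Q_id P1)
  \<comment> \<open>The derivative of the intercept is - t times the second derivative of Q. On the
    half-line t \<ge> 0 the intercept therefore decreases to its value 0 at t = 1.\<close>
  have tangent_deriv: "((\<lambda>t. Q t - t * P t) has_real_derivative - (t * (inverse (R 1) * w t))) (at t)" for t
    by (auto intro!: derivative_eq_intros Q P_deriv)
  have tangent_ge: "0 \<le> Q t - t * P t" if "0 \<le> t" for t
  proof (cases "1 \<le> t")
    case False
    have "Q 1 - 1 * P 1 \<le> Q t - t * P t"
    proof (rule DERIV_nonpos_imp_nonincreasing[where f = "\<lambda>t. Q t - t * P t"])
      fix x assume "t \<le> x"
      then have "0 \<le> x * (inverse (R 1) * w x)" using that R1 w0[of x] by auto
      then show "\<exists>y. ((\<lambda>t. Q t - t * P t) has_real_derivative y) (at x) \<and> y \<le> 0"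
        using tangent_deriv[of x] by (metis neg_le_0_iff_le)
    qed (use False in auto)
    then show ?thesis using Q1 P1[of 1] by simp
  qed (simp add: tangent_eq_0)
  have tangent_le: "Q t - t * P t \<le> 1" if "0 \<le> t" for t
  proof (cases "1 \<le> t")
    case False
    then have "Q t \<le> 1" using Q_mono[of t 1] Q1 by simp
    moreover have "0 \<le> t * P t" using that P0 by simp
    ultimately show ?thesis by simp
  qed (simp add: tangent_eq_0)
  show ?thesis
    by (rule that[OF smooth_real.antideriv[OF P_smooth Q] Q Q_id Q0 Q_ge tangent_ge tangent_le tangent_eq_0])
qed

section \<open>The concentrating potentials\<close>

definition admissible_pair ::
    "(real ^ 'n::finite) set \<Rightarrow> real \<Rightarrow> (real ^ 'n \<Rightarrow> real) \<Rightarrow> (real ^ 'n \<Rightarrow> real) \<Rightarrow> bool"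
  where "admissible_pair \<Omega> r V u \<longleftrightarrow>
    (\<forall>x\<in>\<Omega>. 0 \<le> V x) \<and> in_Lp (lebesgue_on \<Omega>) r V \<and> in_W012 \<Omega> u \<and>
    \<not> (AE x in lebesgue_on \<Omega>. u x = 0) \<and> distributional_solution \<Omega> V u"

lemma not_AE_eq_0_if_pos:
  assumes "open \<Omega>" "\<Omega> \<noteq> {}" "\<And>x. x \<in> \<Omega> \<Longrightarrow> 0 < (u x :: real)"
  shows "\<not> (AE x in lebesgue_on \<Omega>. u x = 0)"
proof
  assume "AE x in lebesgue_on \<Omega>. u x = 0"
  moreover have "AE x in lebesgue_on \<Omega>. u x \<noteq> 0"
    using assms(3) by (intro AE_I2) force
  ultimately have "AE x in lebesgue_on \<Omega>. False" by eventually_elim simp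
  then have "ae_filter (lebesgue_on \<Omega>) = bot"
    by (simp add: trivial_limit_def)
  then have "emeasure (lebesgue_on \<Omega>) (space (lebesgue_on \<Omega>)) = 0"
    by (simp add: ae_filter_eq_bot_iff)
  then have "emeasure lebesgue \<Omega> = 0"
    using assms(1) by (simp add: emeasure_restrict_space)
  then have "negligible \<Omega>"
    using assms(1) by (simp add: negligible_iff_emeasure0)
  with assms show False using open_not_negligible by blast
qed

lemma mem_ball_0_iff_inner_self: "0 \<le> R \<Longrightarrow> x \<in> ball 0 (sqrt R) \<longleftrightarrow> x \<bullet> x < R"
  by (simp add: norm_eq_sqrt_inner)

text \<open>The bound is the r-th power of a supremum bound times the volume of the ball of radius
  sqrt e. The denominator bounds u from below on that ball, and K is independent of e, so the limit
  e -> 0 can be taken afterwards. The restriction e \<le> 1 / 2 keeps 2 e within the unit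
  interval.\<close>

lemma concentrating_pairs_exist:
  fixes r :: real
  defines "\<alpha> \<equiv> real CARD('n::finite) / 2"
  assumes card: "2 \<le> CARD('n)" and r: "0 < r"
  obtains K where "0 < K"
    "\<And>e. 0 < e \<Longrightarrow> e \<le> 1 / 2 \<Longrightarrow> \<exists>V u. admissible_pair (ball (0 :: real ^ 'n) 1) r V u \<and>
      (LINT x|lebesgue_on (ball 0 1). norm (V x) powr r) \<le>
        (K * e powr (- \<alpha>) / (if CARD('n) = 2 then - ln e else e * (2 * e) powr (- \<alpha>))) powr r *
        (e powr \<alpha> * measure lborel (ball (0 :: real ^ 'n) 1))"
proof -
  obtain Q P where Q_smooth: "smooth_real Q" and Q: "\<And>t. (Q has_real_derivative P t) (at t)"
    and Q_id: "\<And>t. 1 \<le> t \<Longrightarrow> Q t = t" and Q0: "0 < Q 0" "\<And>t. Q 0 \<le> Q t"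
    and tangent: "\<And>t. 0 \<le> t \<Longrightarrow> 0 \<le> Q t - t * P t" "\<And>t. 0 \<le> t \<Longrightarrow> Q t - t * P t \<le> 1"
      "\<And>t. 1 \<le> t \<Longrightarrow> Q t - t * P t = 0"
    using convex_smoothing_exists by blast
  \<comment> \<open>The factor twice the dimension comes from the Laplacian, the power of
    \<open>Q 0\<close> from the lower bound e * \<open>Q 0\<close> for q.\<close>
  define K where "K = 2 * real CARD('n) * Q 0 powr (- \<alpha> - 1)"
  have "0 < K" using card Q0 by (simp add: K_def)
  have \<alpha>: "1 \<le> \<alpha>" using card by (simp add: \<alpha>_def)
  have "\<exists>V u. admissible_pair (ball (0 :: real ^ 'n) 1) r V u \<and>
      (LINT x|lebesgue_on (ball 0 1). norm (V x) powr r) \<le>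
        (K * e powr (- \<alpha>) / (if CARD('n) = 2 then - ln e else e * (2 * e) powr (- \<alpha>))) powr r *
        (e powr \<alpha> * measure lborel (ball (0 :: real ^ 'n) 1))"
    if e: "0 < e" "e \<le> 1 / 2" for e
  proof -
    define G where "G = (if CARD('n) = 2 then - ln e else e * (2 * e) powr (- \<alpha>))"
    define q where "q s = e * Q (inverse e * s)" for s
    define p where "p s = (- 1) * (q s powr (- \<alpha>))" for s
    define p' where "p' s = \<alpha> * q s powr (- \<alpha> - 1) * P (s / e)" for s
    have q_ge: "e * Q 0 \<le> q s" for s using e Q0 by (simp add: q_def)
    have q_pos: "0 < q s" for s using q_ge[of s] e Q0 by (smt (verit) mult_pos_pos)
    have q_id: "q s = s" if "e \<le> s" for s using that e by (simp add: q_def Q_id field_simps)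
    have q_smooth: "smooth_real q"
      unfolding q_def[abs_def]
      by (rule smooth_real.mult[OF smooth_real.const smooth_real.comp[OF smooth_real.mult Q_smooth]])
        (rule smooth_real.const smooth_real.ident)+
    have q_deriv: "(q has_real_derivative P (s / e)) (at s)" for s
      unfolding q_def[abs_def] using e
      by (auto intro!: derivative_eq_intros DERIV_chain2[OF Q] simp: field_simps)
    have p_smooth: "smooth_real p"
      unfolding p_def[abs_def]
      by (rule smooth_real.mult[OF smooth_real.const smooth_real.powr[OF q_smooth q_pos]])
    have p_deriv: "(p has_real_derivative p' s) (at s)" for s
      unfolding p_def[abs_def] p'_def
      using DERIV_cmult[OF DERIV_fun_powr[OF q_deriv q_pos, of "- \<alpha>"], of "- 1"] by simp
    obtain F where F: "\<And>s. (F has_real_derivative p s) (at s)" and F1: "F 1 = 0"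
      using real_antiderivative_exists[OF smooth_real_isCont[OF p_smooth], of 1 0] by auto
    have F_smooth: "smooth_real F" by (rule smooth_real.antideriv[OF p_smooth F])
    have p_neg: "p s < 0" for s using q_pos[of s] by (simp add: p_def)
    have F_less: "F t < F s" if "s < t" for s t
      using that by (rule DERIV_neg_imp_decreasing) (use F p_neg in blast)
    have F_mono: "F t \<le> F s" if "s \<le> t" for s t
      using F_less[of s t] that by fastforce
    have F_ge: "G \<le> F s" if "s \<le> e" for s
    proof -
      have "G \<le> F e"
      proof (cases "CARD('n) = 2")
        case True
        \<comment> \<open>In the plane \<alpha> = 1 and q is the identity from e on, so the
          derivative of F is -1 / s there and \<open>F 1 = 0\<close> fixes the constant.\<close>
        have "((\<lambda>s. F s + ln s) has_real_derivative 0) (at s)" if "e \<le> s" for s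
        proof -
          have "((\<lambda>s. F s + ln s) has_real_derivative (p s + 1 / s)) (at s)"
            using that e F by (auto intro!: derivative_eq_intros)
          moreover have "p s + 1 / s = 0"
            using that e True q_id by (simp add: p_def \<alpha>_def powr_minus field_simps)
          ultimately show ?thesis by simp
        qed
        then have "F 1 + ln 1 - (F e + ln e) = (1 - e) * 0"
          using MVT2[of e 1 "\<lambda>s. F s + ln s" "\<lambda>s. 0"] e by auto
        with True F1 show ?thesis by (simp add: G_def)
      next
        case False
        \<comment> \<open>In higher dimension the drop of F between e and 2 e suffices, since it
          already has the order of F(e). The rest is at least \<open>F 1 = 0\<close> because F
          decreases and 2 e \<le> 1.\<close>
        obtain z where z: "e < z" "z < 2 * e" "F (2 * e) - F e = (2 * e - e) * p z"
          using MVT2[OF _ F, of e "2 * e"] e by auto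
        have "(2 * e) powr (- \<alpha>) \<le> z powr (- \<alpha>)"
          using z e \<alpha> by (intro powr_mono2') auto
        then have "e * (2 * e) powr (- \<alpha>) \<le> e * z powr (- \<alpha>)"
          using e by simp
        moreover have "0 \<le> F (2 * e)" using F_mono[of "2 * e" 1] e F1 by simp
        moreover have "F e = F (2 * e) + e * z powr (- \<alpha>)"
          using z q_id[of z] by (simp add: p_def)
        moreover have "G = e * (2 * e) powr (- \<alpha>)" using False by (simp add: G_def)
        ultimately show ?thesis by linarith
      qed
      also have "\<dots> \<le> F s" by (rule F_mono[OF that])
      finally show ?thesis .
    qed
    have G_pos: "0 < G" using e by (auto simp: G_def)

    \<comment> \<open>Minus the Laplacian as a function of s: the last factor is q - s q' expressed
      through Q and P at s / e, so the tangent estimates apply directly.\<close>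
    define D where "D s = 2 * real CARD('n) * q s powr (- \<alpha> - 1) * (e * (Q (s / e) - s / e * P (s / e)))" for s
    have D_ge: "0 \<le> D s" if "0 \<le> s" for s
      unfolding D_def using that e tangent(1)[of "s / e"] by (intro mult_nonneg_nonneg) auto
    have D_eq_0: "D s = 0" if "e \<le> s" for s
      unfolding D_def using that e tangent(3)[of "s / e"] by simp
    have D_le: "D s \<le> K * e powr (- \<alpha>)" if "0 \<le> s" for s
    proof -
      have "q s powr (- \<alpha> - 1) \<le> (e * Q 0) powr (- \<alpha> - 1)"
        using q_ge q_pos e Q0 \<alpha> by (intro powr_mono2') auto
      then have "D s \<le> 2 * real CARD('n) * (e * Q 0) powr (- \<alpha> - 1) * (e * 1)"
        unfolding D_def using that e tangent(1,2)[of "s / e"] by (intro mult_mono mult_left_mono) auto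
      also have "\<dots> = K * (e powr (- \<alpha> - 1) * e powr 1)"
        using e Q0 by (simp add: K_def powr_mult)
      also have "\<dots> = K * e powr (- \<alpha>)"
        using e powr_add[of e "- \<alpha> - 1" 1] by simp
      finally show ?thesis .
    qed

    define u :: "real ^ 'n \<Rightarrow> real" where "u x = F (x \<bullet> x)" for x
    have u_smooth: "smooth_vec u"
      unfolding u_def[abs_def] by (rule smooth_vec.comp[OF smooth_vec_inner_self F_smooth])
    have laplacian: "- (\<Sum>i\<in>UNIV. partial_deriv i (partial_deriv i u) x) = D (x \<bullet> x)" for x
    proof -
      \<comment> \<open>Splitting off one factor q gives both terms of the radial Laplacian the same
        power of q. Their coefficients then agree since 4 \<alpha> is twice the dimension.\<close>
      have "q s powr (- \<alpha>) = q s powr (- \<alpha> - 1) * q s" for s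
        using q_pos[of s] powr_add[of "q s" "- \<alpha> - 1" 1] by simp
      moreover have "4 * \<alpha> = 2 * real CARD('n)" by (simp add: \<alpha>_def)
      ultimately have "- (2 * real CARD('n) * p s + 4 * s * p' s) = D s" for s
        using e by (simp add: p_def p'_def D_def q_def field_simps)
      then show ?thesis
        unfolding u_def[abs_def] laplacian_radial[OF F p_deriv] by simp
    qed
    have mem_ball: "x \<in> ball 0 1 \<longleftrightarrow> x \<bullet> x < 1" for x :: "real ^ 'n"
      using mem_ball_0_iff_inner_self[of 1 x] by simp
    have u_pos: "0 < u x" if "x \<in> ball 0 1" for x
      using that F_less F1 unfolding mem_ball u_def by metis
    have u_nonpos: "u x \<le> 0" if "x \<notin> ball 0 1" for x
      using that F_mono[of 1 "x \<bullet> x"] F1 unfolding mem_ball u_def by simp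

    \<comment> \<open>Defined as a quotient, V satisfies the equation wherever u is nonzero, hence
      in the ball, where u is positive.\<close>
    define V where "V x = - (\<Sum>i\<in>UNIV. partial_deriv i (partial_deriv i u) x) / u x" for x
    define B where "B = K * e powr (- \<alpha>) / G"
    have V_ge: "0 \<le> V x" if "x \<in> ball 0 1" for x
      unfolding V_def laplacian using that u_pos D_ge by (intro divide_nonneg_pos) auto
    \<comment> \<open>Although u tends to 0 at the unit sphere, the quotient is harmless there: the
      numerator vanishes once the squared radius reaches e, and on the remaining core u is at least
      G.\<close>
    have V_le: "V x \<le> B * indicator (ball 0 (sqrt e)) x" if "x \<in> ball 0 1" for x
    proof (cases "x \<bullet> x < e")
      case True
      then have "V x \<le> K * e powr (- \<alpha>) / G"
        unfolding V_def laplacian using G_pos F_ge[of "x \<bullet> x"] D_le[of "x \<bullet> x"] D_ge[of "x \<bullet> x"]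
        by (intro frac_le) (auto simp: u_def)
      with True e show ?thesis
        using mem_ball_0_iff_inner_self[of e x] by (simp add: B_def)
    next
      case False
      then show ?thesis
        using mem_ball_0_iff_inner_self[of e x] e D_eq_0[of "x \<bullet> x"] by (simp add: V_def laplacian)
    qed
    have V_norm_le: "norm (V x) \<le> B" if "x \<in> ball 0 1" for x
    proof -
      have "0 \<le> B" using \<open>0 < K\<close> G_pos by (simp add: B_def)
      then show ?thesis using V_ge[OF that] V_le[OF that] by (simp split: split_indicator_asm)
    qed
    have fin: "finite_measure (lebesgue_on (ball (0 :: real ^ 'n) 1))"
      by (rule finite_measure_lebesgue_on) simp
    have V_meas: "V \<in> borel_measurable (lebesgue_on (ball 0 1))"
    proof -
      have "continuous_on UNIV u"
        "continuous_on UNIV (\<lambda>x. - (\<Sum>i\<in>UNIV. partial_deriv i (partial_deriv i u) x))"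
        by (intro continuous_on_minus smooth_vec_continuous smooth_vec_sum smooth_vec_partial_deriv
            u_smooth finite)+
      then have "V \<in> borel_measurable borel"
        unfolding V_def[abs_def] by (intro borel_measurable_divide borel_measurable_continuous_onI)
      then show ?thesis
        by (intro measurable_restrict_space1 measurable_completion) simp
    qed
    have V_Lp: "in_Lp (lebesgue_on (ball 0 1)) r V"
      using V_norm_le by (intro in_Lp_bounded[OF fin V_meas _ r]) auto
    have "distributional_solution (ball 0 1) V u"
    proof (rule distributional_solution_smooth_vec[OF _ u_smooth])
      fix x :: "real ^ 'n" assume "x \<in> ball 0 1"
      then show "- (\<Sum>i\<in>UNIV. partial_deriv i (partial_deriv i u) x) = V x * u x"
        using u_pos[of x] by (simp add: V_def)
    qed simp
    moreover have "in_W012 (ball 0 1) u"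
      by (rule in_W012_smooth_vec[OF _ _ u_smooth u_pos u_nonpos]) auto
    moreover have "\<not> (AE x in lebesgue_on (ball 0 1). u x = 0)"
      by (rule not_AE_eq_0_if_pos[OF _ _ u_pos]) auto
    ultimately have "admissible_pair (ball 0 1) r V u"
      using V_ge V_Lp by (simp add: admissible_pair_def)
    moreover have "(LINT x|lebesgue_on (ball 0 1). norm (V x) powr r) \<le>
        B powr r * (e powr \<alpha> * measure lborel (ball (0 :: real ^ 'n) 1))"
    proof -
      have sub: "ball (0 :: real ^ 'n) (sqrt e) \<subseteq> ball 0 1" using e by (intro subset_ball) simp
      then have ball_sets: "ball 0 (sqrt e) \<in> sets (lebesgue_on (ball (0 :: real ^ 'n) 1))"
        by (auto simp: sets_restrict_space image_iff)
      have "(LINT x|lebesgue_on (ball 0 1). norm (V x) powr r) \<le>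
          (LINT x|lebesgue_on (ball (0 :: real ^ 'n) 1). B powr r * indicator (ball 0 (sqrt e)) x)"
      proof (rule integral_mono)
        show "integrable (lebesgue_on (ball 0 1)) (\<lambda>x. norm (V x) powr r)"
          using V_Lp by (simp add: in_Lp_def)
        show "integrable (lebesgue_on (ball (0 :: real ^ 'n) 1)) (\<lambda>x. B powr r * indicator (ball 0 (sqrt e)) x)"
          using ball_sets finite_measure.emeasure_finite[OF fin]
          by (intro integrable_mult_right integrable_real_indicator) (auto simp: top.not_eq_extremum)
        fix x :: "real ^ 'n" assume "x \<in> space (lebesgue_on (ball 0 1))"
        then have x: "x \<in> ball 0 1" by simp
        show "norm (V x) powr r \<le> B powr r * indicator (ball 0 (sqrt e)) x"
          using V_ge[OF x] V_le[OF x] r by (simp add: powr_mono2 split: split_indicator split_indicator_asm)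
      qed
      also have "\<dots> = B powr r * measure lborel (ball (0 :: real ^ 'n) (sqrt e))"
        using sub ball_sets by (simp add: measure_restrict_space Int_absorb1 Int_absorb2)
      also have "measure lborel (ball (0 :: real ^ 'n) (sqrt e)) = sqrt e ^ CARD('n) * measure lborel (ball (0 :: real ^ 'n) 1)"
        using e content_ball_conv_unit_ball[of "sqrt e" "0 :: real ^ 'n"] by simp
      also have "sqrt e ^ CARD('n) = e powr \<alpha>"
        using e by (simp add: \<alpha>_def powr_half_sqrt[symmetric] powr_powr flip: powr_realpow)
      finally show ?thesis .
    qed
    ultimately show ?thesis unfolding B_def G_def by blast
  qed
  with \<open>0 < K\<close> show ?thesis by (rule that)
qed

theorem proposition2p2:
  fixes r :: real
  assumes "(CARD('n::finite) \<ge> 3 \<and> 0 < r \<and> r < real CARD('n) / 2) \<or> (CARD('n) = 2 \<and> r = 1)"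
  shows "\<exists>(V :: real \<Rightarrow> real ^ 'n \<Rightarrow> real) (u :: real \<Rightarrow> real ^ 'n \<Rightarrow> real).
    (\<forall>\<epsilon>>0.
      (\<forall>x\<in>ball 0 1. 0 \<le> V \<epsilon> x) \<and>
      in_Lp (lebesgue_on (ball 0 1)) r (V \<epsilon>) \<and>
      in_W012 (ball 0 1) (u \<epsilon>) \<and>
      \<not> (AE x in lebesgue_on (ball 0 1). u \<epsilon> x = 0) \<and>
      distributional_solution (ball 0 1) (V \<epsilon>) (u \<epsilon>)) \<and>
    ((\<lambda>\<epsilon>. Lp_norm (lebesgue_on (ball 0 1)) r (V \<epsilon>)) \<longlongrightarrow> 0) (at_right 0)"
proof -
  have r: "0 < r" and card: "2 \<le> CARD('n)" using assms by auto
  define \<alpha> where "\<alpha> = real CARD('n) / 2"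
  define \<omega> where "\<omega> = measure lborel (ball (0 :: real ^ 'n) 1)"
  obtain K where K: "0 < K" and ex: "\<And>e. 0 < e \<Longrightarrow> e \<le> 1 / 2 \<Longrightarrow>
      \<exists>V u. admissible_pair (ball (0 :: real ^ 'n) 1) r V u \<and>
      (LINT x|lebesgue_on (ball 0 1). norm (V x) powr r) \<le>
        (K * e powr (- \<alpha>) / (if CARD('n) = 2 then - ln e else e * (2 * e) powr (- \<alpha>))) powr r *
        (e powr \<alpha> * \<omega>)"
    unfolding \<alpha>_def \<omega>_def by (rule concentrating_pairs_exist[OF card r]) blast
  define b where "b e = (K * e powr (- \<alpha>) / (if CARD('n) = 2 then - ln e else e * (2 * e) powr (- \<alpha>))) powr r *
        (e powr \<alpha> * \<omega>)" for e
  have b_lim: "(b \<longlongrightarrow> 0) (at_right 0)"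
  proof (cases "CARD('n) = 2")
    case True
    then have [simp]: "\<alpha> = 1" "r = 1" using assms by (auto simp: \<alpha>_def)
    have "((\<lambda>e. K * \<omega> / (- ln e)) \<longlongrightarrow> 0) (at_right 0)"
      by real_asymp
    \<comment> \<open>The factor 1 / e from the potential and the factor e from the volume
      cancel.\<close>
    moreover have "\<forall>\<^sub>F e in at_right 0. K * \<omega> / (- ln e) = b e"
      unfolding eventually_at_right_field
    proof (intro exI[of _ 1] conjI allI impI)
      fix e :: real assume e: "0 < e" "e < 1"
      then have "0 < - ln e" by simp
      then have "b e = K * inverse e / (- ln e) * (e * \<omega>)"
        using e K True by (simp add: b_def powr_minus)
      also have "\<dots> = K * \<omega> / (- ln e)"
        using e by simp
      finally show "K * \<omega> / (- ln e) = b e" ..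
    qed simp
    ultimately show ?thesis by (rule Lim_transform_eventually)
  next
    case False
    then have "0 < \<alpha> - r" using assms by (auto simp: \<alpha>_def)
    then have "((\<lambda>e. (K * 2 powr \<alpha>) powr r * \<omega> * e powr (\<alpha> - r)) \<longlongrightarrow> (K * 2 powr \<alpha>) powr r * \<omega> * 0) (at_right 0)"
      by (intro tendsto_mult tendsto_const tendsto_zero_powrI tendsto_ident_at)
        (auto simp: eventually_at_right_field intro!: exI[of _ 1])
    \<comment> \<open>The supremum bound simplifies to K * 2 powr \<alpha> / e. Its r-th power
      against the volume factor e powr \<alpha> leaves the exponent \<alpha> - r, which is positive
      by r < n/2.\<close>
    moreover have "\<forall>\<^sub>F e in at_right 0. (K * 2 powr \<alpha>) powr r * \<omega> * e powr (\<alpha> - r) = b e"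
      unfolding eventually_at_right_field
    proof (intro exI[of _ 1] conjI allI impI)
      fix e :: real assume e: "0 < e" "e < 1"
      then have "K * e powr (- \<alpha>) / (e * (2 * e) powr (- \<alpha>)) = K * 2 powr \<alpha> / e"
        by (simp add: powr_mult powr_minus field_simps)
      with e K False show "(K * 2 powr \<alpha>) powr r * \<omega> * e powr (\<alpha> - r) = b e"
        by (simp add: b_def powr_divide powr_diff field_simps)
    qed simp
    ultimately show ?thesis by (auto intro: Lim_transform_eventually)
  qed
  obtain V u where Vu: "\<And>e. 0 < e \<Longrightarrow> e \<le> 1 / 2 \<Longrightarrow> admissible_pair (ball (0 :: real ^ 'n) 1) r (V e) (u e)"
    "\<And>e. 0 < e \<Longrightarrow> e \<le> 1 / 2 \<Longrightarrow> (LINT x|lebesgue_on (ball 0 1). norm (V e x) powr r) \<le> b e"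
    using ex unfolding b_def[symmetric] by metis
  \<comment> \<open>A pair is required for every positive parameter, but the construction covers
    only those up to 1 / 2. Capping the parameter fills the gap and leaves the limit at 0
    unchanged.\<close>
  have "((\<lambda>e. LINT x|lebesgue_on (ball 0 1). norm (V (min e (1 / 2)) x) powr r) \<longlongrightarrow> 0) (at_right 0)"
  proof (rule tendsto_sandwich[OF _ _ tendsto_const b_lim])
    show "\<forall>\<^sub>F e in at_right 0. 0 \<le> (LINT x|lebesgue_on (ball 0 1). norm (V (min e (1 / 2)) x) powr r)"
      by simp
    show "\<forall>\<^sub>F e in at_right 0. (LINT x|lebesgue_on (ball 0 1). norm (V (min e (1 / 2)) x) powr r) \<le> b e"
      using Vu(2) by (auto simp: eventually_at_right_field min_def intro!: exI[of _ "1 / 2"])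
  qed
  then have "((\<lambda>e. Lp_norm (lebesgue_on (ball 0 1)) r (V (min e (1 / 2)))) \<longlongrightarrow> 0) (at_right 0)"
    unfolding Lp_norm_def using r by (intro tendsto_zero_powrI[OF _ tendsto_const]) auto
  moreover have "admissible_pair (ball 0 1) r (V (min e (1 / 2))) (u (min e (1 / 2)))" if "0 < e" for e
    using that by (intro Vu(1)) auto
  ultimately show ?thesis
    unfolding admissible_pair_def
    by (intro exI[of _ "\<lambda>e. V (min e (1 / 2))"] exI[of _ "\<lambda>e. u (min e (1 / 2))"]) auto
qed

end
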